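(* Let $n\ge1$, let $\alpha\in\mathcal{T}_n$ be an idempotent of rank $l>2$, and consider the variant $(\mathcal{T}_n,* )$ with $\beta*\gamma=\beta\alpha\gamma$. Let $T$ be an isolated subsemigroup of $(\mathcal{T}_n,* )$ such that $T\not\subseteq\mathcal{T}_n^{(l)}\cup\mathcal{T}_n^{(l-1)}$. Then $T\supseteq\mathcal{T}_n\setminus\mathcal{T}_n^{(l)}$.
   Context: A subsemigroup $T$ of a semigroup $S$ is isolated if for all $x\in S$: $x^j\in T$ for some $j>0$ implies $x\in T$. $\mathcal{T}_n$ is the set of all maps from $N=\{1,\dots,n\}$ to itself, composed from left to right: $(\beta\gamma)(x)=\gamma(\beta(x))$; $\operatorname{rank}(\beta)=|\operatorname{im}(\beta)|$. $\alpha\in\mathcal{T}_n$ is an idempotent ($\alpha\alpha=\alpha$) of rank $l$. The variant $(\mathcal{T}_n,* )$ has operation $\beta*\gamma=\beta\alpha\gamma$. For $\beta\in\mathcal{T}_n$ let $\varepsilon$ be the unique idempotent in the cyclic subsemigroup of $(\mathcal{T}_n,* )$ generated by $\beta$; the stable rank of $\beta$ is $\operatorname{rank}(\varepsilon)$. It is at most $l$. $\mathcal{T}_n^{(i)}$ is the set of elements of stable rank $i$. *)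

theory Defs
  imports "HOL-Library.FuncSet"
begin

definition subsemigroup :: "'a set \<Rightarrow> ('a \<Rightarrow> 'a \<Rightarrow> 'a) \<Rightarrow> 'a set \<Rightarrow> bool" where
  "subsemigroup S f T \<longleftrightarrow> T \<subseteq> S \<and> T \<noteq> {} \<and> (\<forall>x\<in>T. \<forall>y\<in>T. f x y \<in> T)"

text \<open>Only positive exponents are meaningful, as there need not be an identity:
  \<open>sg_pow f x 1 = x\<close> and \<open>sg_pow f x (j + 1) = f (sg_pow f x j) x\<close> for \<open>j > 0\<close>.
  The value at \<open>0\<close> is the junk value \<open>x\<close>.\<close>

definition sg_pow :: "('a \<Rightarrow> 'a \<Rightarrow> 'a) \<Rightarrow> 'a \<Rightarrow> nat \<Rightarrow> 'a" where
  "sg_pow f x j = ((\<lambda>y. f y x) ^^ (j - 1)) x"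

definition cyclic_subsemigroup :: "('a \<Rightarrow> 'a \<Rightarrow> 'a) \<Rightarrow> 'a \<Rightarrow> 'a set" where
  "cyclic_subsemigroup f x = {sg_pow f x j | j. j > 0}"

definition isolated_subsemigroup :: "'a set \<Rightarrow> ('a \<Rightarrow> 'a \<Rightarrow> 'a) \<Rightarrow> 'a set \<Rightarrow> bool" where
  "isolated_subsemigroup S f T \<longleftrightarrow>
     subsemigroup S f T \<and> (\<forall>x\<in>S. (\<exists>j>0. sg_pow f x j \<in> T) \<longrightarrow> x \<in> T)"

text \<open>Maps are represented as extensional functions, so that equality of elements is
  equality of maps on \<open>{1..n}\<close>.\<close>

definition full_transf :: "nat \<Rightarrow> (nat \<Rightarrow> nat) set" where
  "full_transf n = {1..n} \<rightarrow>\<^sub>E {1..n}"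

text \<open>Left-to-right composition: the first factor is applied first.\<close>

definition tmult :: "nat \<Rightarrow> (nat \<Rightarrow> nat) \<Rightarrow> (nat \<Rightarrow> nat) \<Rightarrow> nat \<Rightarrow> nat" where
  "tmult n \<beta> \<gamma> = compose {1..n} \<gamma> \<beta>"

definition trank :: "nat \<Rightarrow> (nat \<Rightarrow> nat) \<Rightarrow> nat" where
  "trank n \<beta> = card (\<beta> ` {1..n})"

definition variant_mult ::
    "nat \<Rightarrow> (nat \<Rightarrow> nat) \<Rightarrow> (nat \<Rightarrow> nat) \<Rightarrow> (nat \<Rightarrow> nat) \<Rightarrow> nat \<Rightarrow> nat" where
  "variant_mult n \<alpha> \<beta> \<gamma> = tmult n (tmult n \<beta> \<alpha>) \<gamma>"

text \<open>The description is proper for \<open>\<alpha>, \<beta> \<in> full_transf n\<close>: a finite cyclic semigroup contains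
  exactly one idempotent. Idempotency is with respect to the variant operation, while the rank is
  the ordinary size of the image.\<close>

definition stable_rank :: "nat \<Rightarrow> (nat \<Rightarrow> nat) \<Rightarrow> (nat \<Rightarrow> nat) \<Rightarrow> nat" where
  "stable_rank n \<alpha> \<beta> =
     trank n (THE \<epsilon>. \<epsilon> \<in> cyclic_subsemigroup (variant_mult n \<alpha>) \<beta> \<and> variant_mult n \<alpha> \<epsilon> \<epsilon> = \<epsilon>)"

definition stable_rank_class :: "nat \<Rightarrow> (nat \<Rightarrow> nat) \<Rightarrow> nat \<Rightarrow> (nat \<Rightarrow> nat) set" where
  "stable_rank_class n \<alpha> i = {\<beta> \<in> full_transf n. stable_rank n \<alpha> \<beta> = i}"

end

theory Submission
  imports Defs "HOL-Combinatorics.Transposition"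
begin

text \<open>Write \<open>A\<close> for the image of \<open>\<alpha>\<close>. By isolation, \<open>T\<close> contains a map as soon as it contains
  its idempotent power, so only idempotents of the variant matter. Let \<open>\<epsilon> \<in> T\<close> be such an
  idempotent with at least two points \<open>a\<close>, \<open>a'\<close> of \<open>A\<close> outside \<open>\<alpha>(im \<epsilon>)\<close>. Some roots of \<open>\<epsilon>\<close> send
  \<open>a\<close> to \<open>a'\<close> or \<open>a'\<close> to \<open>a\<close>, and their product is an idempotent in \<open>T\<close> that has the extra
  image point \<open>a\<close>. Permuting the images of the two idempotents obtained in this way and
  multiplying gives elements of \<open>T\<close> of smaller stable rank, hence a constant map, and by the same
  device all constant maps. Conversely, every idempotent of rank \<open>k\<close> with \<open>1 < k < l\<close> is a product
  of two maps of stable rank less than \<open>k\<close>, so an induction on the rank finishes the proof.\<close>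

section \<open>Powers in a finite semigroup\<close>

locale finite_semigroup =
  fixes S :: "'a set" and f :: "'a \<Rightarrow> 'a \<Rightarrow> 'a"
  assumes finite: "finite S"
    and closed: "\<And>x y. x \<in> S \<Longrightarrow> y \<in> S \<Longrightarrow> f x y \<in> S"
    and assoc: "\<And>x y z. x \<in> S \<Longrightarrow> y \<in> S \<Longrightarrow> z \<in> S \<Longrightarrow> f (f x y) z = f x (f y z)"
begin

lemma sg_pow_Suc: "j > 0 \<Longrightarrow> sg_pow f x (Suc j) = f (sg_pow f x j) x"
  by (cases j) (simp_all add: sg_pow_def)

lemma sg_pow_1: "sg_pow f x (Suc 0) = x"
  by (simp add: sg_pow_def)

lemma sg_pow_closed:
  assumes "x \<in> S"
  shows "sg_pow f x j \<in> S"
proof (induction j)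
  case 0
  then show ?case using assms by (simp add: sg_pow_def)
next
  case (Suc j)
  then show ?case using assms closed sg_pow_1 sg_pow_Suc by (cases "j = 0") auto
qed

lemma sg_pow_add:
  assumes "x \<in> S" "i > 0" "j > 0"
  shows "sg_pow f x (i + j) = f (sg_pow f x i) (sg_pow f x j)"
  using \<open>j > 0\<close>
proof (induction j rule: nat_induct_non_zero)
  case 1
  then show ?case using assms by (simp add: sg_pow_1 sg_pow_Suc)
next
  case (Suc j)
  then show ?case using assms by (simp add: sg_pow_Suc assoc sg_pow_closed)
qed

lemma sg_pow_mult_idem:
  assumes "x \<in> S" "i > 0" "j > 0" "f (sg_pow f x i) (sg_pow f x i) = sg_pow f x i"
  shows "sg_pow f x (i * j) = sg_pow f x i"
  using \<open>j > 0\<close>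
proof (induction j rule: nat_induct_non_zero)
  case 1
  then show ?case by simp
next
  case (Suc j)
  then show ?case using assms by (simp add: sg_pow_add)
qed

text \<open>If \<open>d\<close> and \<open>e\<close> are the powers with exponents \<open>i\<close>
  and \<open>j\<close>, then both equal the power with exponent \<open>i * j\<close>, since powers
  of an idempotent do not change it.\<close>

lemma idempotent_power_unique:
  assumes "x \<in> S" "d \<in> cyclic_subsemigroup f x" "f d d = d"
    and "e \<in> cyclic_subsemigroup f x" "f e e = e"
  shows "d = e"
proof -
  obtain i where i: "i > 0" "d = sg_pow f x i"
    using assms by (auto simp: cyclic_subsemigroup_def)
  obtain j where j: "j > 0" "e = sg_pow f x j"
    using assms by (auto simp: cyclic_subsemigroup_def)
  have "sg_pow f x (i * j) = d" "sg_pow f x (j * i) = e"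
    using assms i j sg_pow_mult_idem by auto
  then show ?thesis by (simp add: mult.commute)
qed

text \<open>By finiteness two powers coincide, so from some exponent \<open>i\<close> on the powers
  have a period \<open>p\<close>. The exponent \<open>i * p\<close> is at least \<open>i\<close>,
  and doubling it adds \<open>i\<close> whole periods, which gives the idempotent.\<close>

lemma idempotent_power_exists:
  assumes x: "x \<in> S"
  shows "\<exists>j>0. f (sg_pow f x j) (sg_pow f x j) = sg_pow f x j"
proof -
  have "\<not> inj_on (sg_pow f x) {1..}"
    using finite_subset[OF _ finite, of "sg_pow f x ` {1..}"] sg_pow_closed[OF x]
      finite_imageD infinite_Ici by blast
  then obtain i j where ij: "1 \<le> i" "i < j" "sg_pow f x i = sg_pow f x j"
    unfolding inj_on_def by (metis atLeast_iff linorder_neqE_nat)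
  define p where "p = j - i"
  have p: "p > 0" "sg_pow f x (i + p) = sg_pow f x i" using ij by (auto simp: p_def)
  have shift: "sg_pow f x (m + p) = sg_pow f x m" if "m \<ge> i" for m
  \<comment> \<open>\<open>sg_pow_add\<close> needs positive exponents, so the split of
    \<open>m\<close> into \<open>i\<close> and a remainder requires \<open>m > i\<close>.\<close>
  proof (cases "m = i")
    case True
    then show ?thesis using p by simp
  next
    case False
    define d where "d = m - i"
    with False that have d: "m = i + d" "d > 0" by auto
    have "sg_pow f x (m + p) = sg_pow f x ((i + p) + d)" using d by (simp add: ac_simps)
    also have "\<dots> = sg_pow f x m"
      using sg_pow_add[OF x, of "i + p" d] sg_pow_add[OF x, of i d] p d ij by simp
    finally show ?thesis .
  qed
  have "sg_pow f x (i * p + k * p) = sg_pow f x (i * p)" for k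
  proof (induction k)
    case (Suc k)
    have "i * p + k * p \<ge> i"
      using p by (metis Suc_leI mult.right_neutral mult_le_mono2 One_nat_def trans_le_add1)
    then show ?case using shift[of "i * p + k * p"] Suc by (simp add: ac_simps)
  qed simp
  from this[of i] have "f (sg_pow f x (i * p)) (sg_pow f x (i * p)) = sg_pow f x (i * p)"
    using sg_pow_add[OF x, of "i * p" "i * p"] ij p by simp
  moreover have "i * p > 0" using ij p by simp
  ultimately show ?thesis by blast
qed

end

section \<open>Idempotents of the variant\<close>

locale transf_variant =
  fixes n :: nat and \<alpha> :: "nat \<Rightarrow> nat"
  assumes n_pos: "n \<ge> 1"
    and alpha: "\<alpha> \<in> full_transf n"
    and alpha_idem: "tmult n \<alpha> \<alpha> = \<alpha>"
begin

text \<open>An opaque name keeps the simplifier from turning membership in the interval into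
  inequalities.\<close>

definition N :: "nat set" where "N = {1..n}"

lemma finite_N [simp]: "finite N"
  by (simp add: N_def)

lemma N_nonempty [simp]: "N \<noteq> {}"
  using n_pos by (simp add: N_def)

lemma full_transf_N: "full_transf n = N \<rightarrow>\<^sub>E N"
  by (simp add: full_transf_def N_def)

lemma trank_N: "trank n \<beta> = card (\<beta> ` N)"
  by (simp add: trank_def N_def)

abbreviation star :: "(nat \<Rightarrow> nat) \<Rightarrow> (nat \<Rightarrow> nat) \<Rightarrow> nat \<Rightarrow> nat" (infixl "\<star>" 70)
  where "\<beta> \<star> \<gamma> \<equiv> variant_mult n \<alpha> \<beta> \<gamma>"

definition idem :: "(nat \<Rightarrow> nat) \<Rightarrow> bool"
  where "idem \<epsilon> \<longleftrightarrow> \<epsilon> \<in> full_transf n \<and> \<epsilon> \<star> \<epsilon> = \<epsilon>"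

lemma full_in: "\<beta> \<in> full_transf n \<Longrightarrow> u \<in> N \<Longrightarrow> \<beta> u \<in> N"
  unfolding full_transf_N by (rule PiE_mem)

lemma full_eqI:
  "\<beta> \<in> full_transf n \<Longrightarrow> \<gamma> \<in> full_transf n \<Longrightarrow> (\<And>u. u \<in> N \<Longrightarrow> \<beta> u = \<gamma> u) \<Longrightarrow> \<beta> = \<gamma>"
  unfolding full_transf_N by (rule PiE_ext)

lemma full_restrict: "(\<And>u. u \<in> N \<Longrightarrow> F u \<in> N) \<Longrightarrow> (\<lambda>u\<in>N. F u) \<in> full_transf n"
  unfolding full_transf_N by (intro restrict_PiE_iff[THEN iffD2]) auto

lemma full_upd: "\<beta> \<in> full_transf n \<Longrightarrow> a \<in> N \<Longrightarrow> w \<in> N \<Longrightarrow> \<beta>(a := w) \<in> full_transf n"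
  unfolding full_transf_N by (auto simp: PiE_iff extensional_def)

lemma alpha_in: "u \<in> N \<Longrightarrow> \<alpha> u \<in> N"
  using alpha full_in by blast

lemma alpha_alpha: "u \<in> N \<Longrightarrow> \<alpha> (\<alpha> u) = \<alpha> u"
  using fun_cong[OF alpha_idem, of u] by (simp add: tmult_def compose_def N_def)

lemma alpha_fix: "a \<in> \<alpha> ` N \<Longrightarrow> \<alpha> a = a"
  using alpha_alpha by auto

lemma star_apply: "u \<in> N \<Longrightarrow> (\<beta> \<star> \<gamma>) u = \<gamma> (\<alpha> (\<beta> u))"
  by (simp add: variant_mult_def tmult_def compose_def N_def)

lemma star_full: "\<beta> \<in> full_transf n \<Longrightarrow> \<gamma> \<in> full_transf n \<Longrightarrow> \<beta> \<star> \<gamma> \<in> full_transf n"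
  unfolding variant_mult_def tmult_def compose_def N_def[symmetric]
  by (rule full_restrict) (simp add: full_in alpha_in)

sublocale finite_semigroup "full_transf n" "variant_mult n \<alpha>"
proof
  show "finite (full_transf n)" unfolding full_transf_N by (simp add: finite_PiE)
  show "\<beta> \<star> \<gamma> \<in> full_transf n" if "\<beta> \<in> full_transf n" "\<gamma> \<in> full_transf n" for \<beta> \<gamma>
    using star_full that .
  show "\<beta> \<star> \<gamma> \<star> \<delta> = \<beta> \<star> (\<gamma> \<star> \<delta>)"
    if "\<beta> \<in> full_transf n" "\<gamma> \<in> full_transf n" "\<delta> \<in> full_transf n" for \<beta> \<gamma> \<delta>
    by (rule full_eqI) (simp_all add: that star_full star_apply full_in alpha_in)
qed

section \<open>Idempotents of the variant and their images\<close>

lemma idem_apply: "idem \<epsilon> \<Longrightarrow> u \<in> N \<Longrightarrow> \<epsilon> (\<alpha> (\<epsilon> u)) = \<epsilon> u"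
  using star_apply[of u \<epsilon> \<epsilon>] by (simp add: idem_def)

lemma idem_image: "idem \<epsilon> \<Longrightarrow> e \<in> \<epsilon> ` N \<Longrightarrow> \<epsilon> (\<alpha> e) = e"
  using idem_apply by auto

lemma idemI:
  "\<epsilon> \<in> full_transf n \<Longrightarrow> (\<And>u. u \<in> N \<Longrightarrow> \<epsilon> (\<alpha> (\<epsilon> u)) = \<epsilon> u) \<Longrightarrow> idem \<epsilon>"
  unfolding idem_def by (metis full_eqI star_apply star_full)

lemma idem_full: "idem \<epsilon> \<Longrightarrow> \<epsilon> \<in> full_transf n"
  by (simp add: idem_def)

lemma idem_image_subset: "idem \<epsilon> \<Longrightarrow> \<epsilon> ` N \<subseteq> N"
  using full_in idem_full by blast

lemma idem_image_in:
  assumes "idem \<epsilon>" "e \<in> \<epsilon> ` N"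
  shows "e \<in> N" "\<alpha> e \<in> N"
  using subsetD[OF idem_image_subset] assms alpha_in by blast+

lemma idem_image_neq: "e \<in> \<epsilon> ` N \<Longrightarrow> a \<notin> \<alpha> ` \<epsilon> ` N \<Longrightarrow> \<alpha> e \<noteq> a"
  by blast

lemma idem_inj: "idem \<epsilon> \<Longrightarrow> inj_on \<alpha> (\<epsilon> ` N)"
  by (metis idem_image inj_onI)

lemma card_alpha_image: "idem \<epsilon> \<Longrightarrow> card (\<alpha> ` \<epsilon> ` N) = card (\<epsilon> ` N)"
  by (simp add: card_image idem_inj)

lemma alpha_image_subset: "idem \<epsilon> \<Longrightarrow> \<alpha> ` \<epsilon> ` N \<subseteq> \<alpha> ` N"
  using idem_image_subset by blast

lemma card_idem_le: "idem \<epsilon> \<Longrightarrow> card (\<epsilon> ` N) \<le> card (\<alpha> ` N)"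
  by (metis card_alpha_image alpha_image_subset card_mono finite_imageI finite_N)

lemma card_image_pos: "card (\<beta> ` N) > 0"
  by (simp add: card_gt_0_iff)

lemma idem_rank_1:
  assumes "idem \<epsilon>" "card (\<epsilon> ` N) = 1"
  obtains v where "v \<in> N" "\<epsilon> = (\<lambda>u\<in>N. v)"
proof -
  obtain v where v: "\<epsilon> ` N = {v}" using assms(2) by (rule card_1_singletonE)
  then have v_N: "v \<in> N" using idem_image_subset[OF assms(1)] by blast
  have "\<epsilon> = (\<lambda>u\<in>N. v)"
  proof (rule full_eqI)
    show "\<epsilon> u = (\<lambda>u\<in>N. v) u" if "u \<in> N" for u using imageI[OF that, of \<epsilon>] v that by simp
  qed (use assms v_N in \<open>simp_all add: idem_full full_restrict\<close>)
  then show thesis using that v_N by blast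
qed

text \<open>The new value \<open>w\<close> returns to \<open>a\<close> under \<open>\<alpha>\<close>
  and so reproduces itself; the old values never reach \<open>a\<close> under
  \<open>\<alpha>\<close>, so the update does not disturb them.\<close>

lemma idem_upd:
  assumes "idem \<epsilon>" "a \<in> N" "a \<notin> \<alpha> ` \<epsilon> ` N" "w \<in> N" "\<alpha> w = a"
  shows "idem (\<epsilon>(a := w))"
proof (rule idemI)
  show "\<epsilon>(a := w) \<in> full_transf n" using assms by (simp add: full_upd idem_full)
  show "(\<epsilon>(a := w)) (\<alpha> ((\<epsilon>(a := w)) u)) = (\<epsilon>(a := w)) u" if "u \<in> N" for u
    using assms that idem_apply[of \<epsilon> u] by (cases "u = a") (auto simp: image_iff)
qed

lemma obtain_idem_power:
  assumes "\<beta> \<in> full_transf n"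
  obtains j where "j > 0" "idem (sg_pow (\<star>) \<beta> j)" "sg_pow (\<star>) \<beta> j ` N \<subseteq> \<beta> ` N"
    "stable_rank n \<alpha> \<beta> = card (sg_pow (\<star>) \<beta> j ` N)"
proof -
  obtain j where j: "j > 0" "sg_pow (\<star>) \<beta> j \<star> sg_pow (\<star>) \<beta> j = sg_pow (\<star>) \<beta> j"
    using idempotent_power_exists assms by blast
  \<comment> \<open>The last factor of the power is \<open>\<beta>\<close> and it is applied last,
    so its image bounds the image of the power.\<close>
  have "sg_pow (\<star>) \<beta> j ` N \<subseteq> \<beta> ` N"
  proof (cases "j = 1")
    case True
    then show ?thesis by (simp add: sg_pow_1)
  next
    case False
    then obtain i where i: "j = Suc i" "i > 0"
      using j by (cases j) auto
    have "sg_pow (\<star>) \<beta> j u \<in> \<beta> ` N" if "u \<in> N" for u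
      unfolding i(1) sg_pow_Suc[OF i(2)] star_apply[OF that]
      by (intro imageI alpha_in full_in[OF sg_pow_closed[OF assms] that])
    then show ?thesis by blast
  qed
  moreover have "(THE \<epsilon>. \<epsilon> \<in> cyclic_subsemigroup (\<star>) \<beta> \<and> \<epsilon> \<star> \<epsilon> = \<epsilon>) = sg_pow (\<star>) \<beta> j"
  proof (rule the_equality)
    show "sg_pow (\<star>) \<beta> j \<in> cyclic_subsemigroup (\<star>) \<beta> \<and>
        sg_pow (\<star>) \<beta> j \<star> sg_pow (\<star>) \<beta> j = sg_pow (\<star>) \<beta> j"
      using j by (auto simp: cyclic_subsemigroup_def)
    then show "\<epsilon> = sg_pow (\<star>) \<beta> j"
      if "\<epsilon> \<in> cyclic_subsemigroup (\<star>) \<beta> \<and> \<epsilon> \<star> \<epsilon> = \<epsilon>" for \<epsilon>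
      using idempotent_power_unique[OF assms] that by blast
  qed
  then have "stable_rank n \<alpha> \<beta> = card (sg_pow (\<star>) \<beta> j ` N)"
    by (simp only: stable_rank_def trank_N)
  moreover have "idem (sg_pow (\<star>) \<beta> j)"
    using j sg_pow_closed[OF assms] by (simp add: idem_def)
  ultimately show thesis using that j by blast
qed

end

section \<open>Isolated subsemigroups of the variant\<close>

locale isolated_variant = transf_variant +
  fixes T :: "(nat \<Rightarrow> nat) set"
  assumes isolated: "isolated_subsemigroup (full_transf n) (variant_mult n \<alpha>) T"
begin

section \<open>Membership in \<open>T\<close> through products and roots\<close>

lemma T_full: "\<beta> \<in> T \<Longrightarrow> \<beta> \<in> full_transf n"
  using isolated by (auto simp: isolated_subsemigroup_def subsemigroup_def)

lemma T_star: "\<beta> \<in> T \<Longrightarrow> \<gamma> \<in> T \<Longrightarrow> \<beta> \<star> \<gamma> \<in> T"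
  using isolated by (auto simp: isolated_subsemigroup_def subsemigroup_def)

lemma T_root: "\<beta> \<in> full_transf n \<Longrightarrow> j > 0 \<Longrightarrow> sg_pow (\<star>) \<beta> j \<in> T \<Longrightarrow> \<beta> \<in> T"
  using isolated by (auto simp: isolated_subsemigroup_def)

lemma T_square_root: "\<beta> \<in> full_transf n \<Longrightarrow> \<beta> \<star> \<beta> \<in> T \<Longrightarrow> \<beta> \<in> T"
  using T_root[of \<beta> 2] by (simp add: sg_pow_def)

lemma T_square_rootI:
  assumes "\<epsilon> \<in> T" "\<beta> \<in> full_transf n" "\<And>u. u \<in> N \<Longrightarrow> \<beta> (\<alpha> (\<beta> u)) = \<epsilon> u"
  shows "\<beta> \<in> T"
proof -
  have "\<beta> \<star> \<beta> = \<epsilon>"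
    using assms by (intro full_eqI) (auto simp: star_full star_apply T_full)
  then show ?thesis using assms T_square_root by simp
qed

lemma T_starI:
  assumes "\<beta> \<in> T" "\<gamma> \<in> T" "\<delta> \<in> full_transf n" "\<And>u. u \<in> N \<Longrightarrow> \<gamma> (\<alpha> (\<beta> u)) = \<delta> u"
  shows "\<delta> \<in> T"
proof -
  have "\<beta> \<star> \<gamma> = \<delta>"
    using assms by (intro full_eqI) (auto simp: star_full star_apply T_full)
  then show ?thesis using assms T_star by auto
qed

lemma T_sg_pow:
  assumes "\<beta> \<in> T" "j > 0"
  shows "sg_pow (\<star>) \<beta> j \<in> T"
  using \<open>j > 0\<close>
  by (induction j rule: nat_induct_non_zero) (simp_all add: sg_pow_1 sg_pow_Suc T_star assms(1))

text \<open>The map is a square root of \<open>\<epsilon>\<close>: after the first transposition the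
  value still lies in the image of \<open>\<epsilon>\<close>, where \<open>\<alpha>\<close> followed
  by \<open>\<epsilon>\<close> is the identity, so the second transposition undoes the
  first.\<close>

lemma T_transpose:
  assumes "\<epsilon> \<in> T" "idem \<epsilon>" "p \<in> \<epsilon> ` N" "q \<in> \<epsilon> ` N"
  shows "(\<lambda>u\<in>N. transpose p q (\<epsilon> u)) \<in> T"
proof (rule T_square_rootI[OF \<open>\<epsilon> \<in> T\<close>])
  have im: "transpose p q (\<epsilon> u) \<in> \<epsilon> ` N" if "u \<in> N" for u
    using assms that by (auto simp: transpose_def)
  then show "(\<lambda>u\<in>N. transpose p q (\<epsilon> u)) \<in> full_transf n"
    using idem_image_subset[OF assms(2)] by (intro full_restrict) blast
  show "(\<lambda>u\<in>N. transpose p q (\<epsilon> u)) (\<alpha> ((\<lambda>u\<in>N. transpose p q (\<epsilon> u)) u)) = \<epsilon> u"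
    if u: "u \<in> N" for u
  proof -
    have "\<alpha> (transpose p q (\<epsilon> u)) \<in> N"
      using idem_image_in[OF assms(2) im[OF u]] by simp
    then show ?thesis using u idem_image[OF assms(2) im[OF u]] by simp
  qed
qed

text \<open>The two factors are square roots of \<open>\<epsilon>\<close>, one sending \<open>a\<close> to \<open>a'\<close> and the other \<open>a'\<close> to \<open>w\<close>.
  If \<open>\<epsilon>\<close> separates \<open>a\<close> from \<open>a'\<close>, the roots have to exchange the two image points.\<close>

lemma T_adjoin:
  assumes T: "\<epsilon> \<in> T" and idem: "idem \<epsilon>"
    and a: "a \<in> \<alpha> ` N" "a \<notin> \<alpha> ` \<epsilon> ` N" and a': "a' \<in> \<alpha> ` N" "a' \<notin> \<alpha> ` \<epsilon> ` N"
    and neq: "a \<noteq> a'" and w: "w \<in> N" "\<alpha> w = a"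
  shows "\<epsilon>(a := w) \<in> T"
proof -
  have N: "a \<in> N" "a' \<in> N" using a a' alpha_in by auto
  have A_fix: "\<alpha> a = a" "\<alpha> a' = a'"
    using alpha_fix[OF a(1)] alpha_fix[OF a'(1)] .
  have out: "\<alpha> (\<epsilon> u) \<noteq> a" "\<alpha> (\<epsilon> u) \<noteq> a'" if "u \<in> N" for u using that a a' by blast+
  have goal_full: "\<epsilon>(a := w) \<in> full_transf n" using N w by (simp add: full_upd idem_full[OF idem])
  show ?thesis
  proof (cases "\<epsilon> a = \<epsilon> a'")
    case True
    have x: "\<epsilon>(a := a') \<in> T"
    proof (rule T_square_rootI[OF T])
      show "\<epsilon>(a := a') \<in> full_transf n" using N by (simp add: full_upd idem_full[OF idem])
    qed (use True A_fix out neq idem_apply[OF idem] in auto)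
    have y: "\<epsilon>(a' := w) \<in> T"
    proof (rule T_square_rootI[OF T])
      show "\<epsilon>(a' := w) \<in> full_transf n" using N w by (simp add: full_upd idem_full[OF idem])
    qed (use True A_fix out neq w idem_apply[OF idem] in auto)
    show ?thesis
      by (rule T_starI[OF x y goal_full]) (use True A_fix out neq idem_apply[OF idem] in auto)
  next
    case False
    \<comment> \<open>Another square root of \<open>\<epsilon>\<close>. In \<open>x\<close> the
      point \<open>a\<close> passes through \<open>a'\<close>, so \<open>x\<close> must send
      \<open>a'\<close> to \<open>\<epsilon> a\<close>; the swap carries this value on to \<epsilon>
      a' in the square. The roles are reversed in \<open>y\<close>, and in the product of
      \<open>x\<close> and \<open>y\<close> the two swaps cancel.\<close>
    define \<sigma> where "\<sigma> u = transpose (\<epsilon> a) (\<epsilon> a') (\<epsilon> u)" for u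
    have im: "\<sigma> u \<in> \<epsilon> ` N" if "u \<in> N" for u
      using N that by (auto simp: \<sigma>_def transpose_def)
    then have \<sigma>N: "\<sigma> u \<in> N" "\<alpha> (\<sigma> u) \<in> N" "\<alpha> (\<sigma> u) \<noteq> a" "\<alpha> (\<sigma> u) \<noteq> a'" if "u \<in> N" for u
      using idem_image_in[OF idem im[OF that]] idem_image_neq[OF im[OF that]] a(2) a'(2) by simp_all
    have \<sigma>\<sigma>: "\<sigma> (\<alpha> (\<sigma> u)) = \<epsilon> u" if "u \<in> N" for u
      using idem_image[OF idem im[OF that]] by (simp add: \<sigma>_def)
    have \<sigma>\<epsilon>: "\<sigma> (\<alpha> (\<epsilon> a)) = \<epsilon> a'" "\<sigma> (\<alpha> (\<epsilon> a')) = \<epsilon> a"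
      using idem_apply[OF idem] N by (simp_all add: \<sigma>_def)
    have \<epsilon>N: "\<epsilon> u \<in> N" "\<alpha> (\<epsilon> u) \<in> N" if "u \<in> N" for u
      using that full_in idem_full[OF idem] alpha_in by auto
    define x where "x = (\<lambda>u\<in>N. if u = a then a' else if u = a' then \<epsilon> a else \<sigma> u)"
    define y where "y = (\<lambda>u\<in>N. if u = a' then w else if u = a then \<epsilon> a' else \<sigma> u)"
    have x: "x \<in> T"
    proof (rule T_square_rootI[OF T])
      show "x \<in> full_transf n" unfolding x_def by (rule full_restrict) (use N \<epsilon>N \<sigma>N in auto)
    qed (use N \<epsilon>N A_fix out neq \<sigma>N \<sigma>\<sigma> \<sigma>\<epsilon> in \<open>auto simp: x_def\<close>)
    have y: "y \<in> T"
    proof (rule T_square_rootI[OF T])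
      show "y \<in> full_transf n" unfolding y_def by (rule full_restrict) (use N w \<epsilon>N \<sigma>N in auto)
    qed (use N w \<epsilon>N A_fix out neq \<sigma>N \<sigma>\<sigma> \<sigma>\<epsilon> in \<open>auto simp: y_def\<close>)
    show ?thesis
      by (rule T_starI[OF x y goal_full])
        (use N w \<epsilon>N A_fix out neq \<sigma>N \<sigma>\<sigma> \<sigma>\<epsilon> in \<open>auto simp: x_def y_def\<close>)
  qed
qed

section \<open>Descent to a constant map\<close>

text \<open>Two free points \<open>a\<close> and \<open>a'\<close> are adjoined to
  \<open>\<epsilon>\<close> separately, and each is then swapped with an old image point. The
  product \<open>z\<close> of the two maps loses \<open>b\<close>, its square also loses
  \<open>c\<close>, and only \<open>a'\<close> is gained.\<close>

lemma T_descend: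
  assumes T: "\<epsilon> \<in> T" and idem: "idem \<epsilon>"
    and rank: "card (\<epsilon> ` N) \<ge> 2" "card (\<epsilon> ` N) + 2 \<le> card (\<alpha> ` N)"
  obtains \<delta> where "\<delta> \<in> T" "idem \<delta>" "card (\<delta> ` N) < card (\<epsilon> ` N)"
proof -
  let ?E = "\<epsilon> ` N"
  have "card (\<alpha> ` N - \<alpha> ` ?E) \<ge> 2"
    using rank card_alpha_image[OF idem] alpha_image_subset[OF idem] by (simp add: card_Diff_subset)
  then obtain a a' where "a \<in> \<alpha> ` N - \<alpha> ` ?E" "a' \<in> \<alpha> ` N - \<alpha> ` ?E" "a \<noteq> a'"
    by (metis card_le_Suc0_iff_eq finite_Diff finite_imageI finite_N not_less_eq_eq
        numeral_2_eq_2)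
  then have a: "a \<in> \<alpha> ` N" "a \<notin> \<alpha> ` ?E" and a': "a' \<in> \<alpha> ` N" "a' \<notin> \<alpha> ` ?E" and neq: "a \<noteq> a'"
    by auto
  have N: "a \<in> N" "a' \<in> N" using a a' alpha_in by auto
  have A_fix: "\<alpha> a = a" "\<alpha> a' = a'"
    using alpha_fix[OF a(1)] alpha_fix[OF a'(1)] .
  have E: "a \<notin> ?E" "a' \<notin> ?E" using a a' A_fix by (metis imageI)+
  have "\<not> card ?E \<le> Suc 0" using rank by simp
  then obtain c where "c \<in> ?E" "c \<noteq> \<epsilon> a"
    using N by (auto simp: card_le_Suc0_iff_eq) (metis image_eqI)
  \<comment> \<open>If \<open>\<epsilon>\<close> separates \<open>a\<close> from \<open>a'\<close>,
    the choice is \<open>c = \<epsilon> a'\<close>. Thus \<open>g a'\<close> is \<open>a\<close> or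
    \<open>b\<close>, and \<open>h\<close> after \<open>\<alpha>\<close> sends both to
    \<open>a'\<close>, which makes \<open>z\<close> fix \<open>a'\<close>.\<close>
  then obtain c where c: "c \<in> ?E" "c \<noteq> \<epsilon> a" "\<epsilon> a' \<in> {\<epsilon> a, c}"
    using N by (cases "\<epsilon> a' = \<epsilon> a") auto
  \<comment> \<open>With this \<open>b\<close>, the swap in \<open>h\<close> turns the value
    \<open>\<epsilon> a\<close> into \<open>a'\<close>, so \<open>h a = a'\<close>.\<close>
  define b where "b = \<epsilon> a"
  have b: "b \<in> ?E" "c \<noteq> b" using N c by (auto simp: b_def)
  define g where "g = (\<lambda>u\<in>N. transpose a c ((\<epsilon>(a := a)) u))"
  define h where "h = (\<lambda>u\<in>N. transpose a' b ((\<epsilon>(a' := a')) u))"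
  have in_upd: "e \<in> (\<epsilon>(x := x)) ` N" if "e \<in> ?E" "x \<notin> \<alpha> ` ?E" for e x
  proof -
    have "\<alpha> e \<in> N" "\<alpha> e \<noteq> x" using that idem_image_in[OF idem] idem_image_neq by simp_all
    then show ?thesis using idem_image[OF idem that(1)] by (metis fun_upd_other imageI)
  qed
  have g: "g \<in> T" unfolding g_def
  proof (rule T_transpose)
    show "\<epsilon>(a := a) \<in> T" using T_adjoin[OF T idem a a' neq N(1) A_fix(1)] .
    show "idem (\<epsilon>(a := a))" using idem_upd[OF idem N(1) a(2) N(1) A_fix(1)] .
    show "a \<in> (\<epsilon>(a := a)) ` N" using N by (metis fun_upd_same imageI)
    show "c \<in> (\<epsilon>(a := a)) ` N" using in_upd c a by blast
  qed
  have h: "h \<in> T" unfolding h_def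
  proof (rule T_transpose)
    show "\<epsilon>(a' := a') \<in> T" using T_adjoin[OF T idem a' a neq[symmetric] N(2) A_fix(2)] .
    show "idem (\<epsilon>(a' := a'))" using idem_upd[OF idem N(2) a'(2) N(2) A_fix(2)] .
    show "a' \<in> (\<epsilon>(a' := a')) ` N" using N by (metis fun_upd_same imageI)
    show "b \<in> (\<epsilon>(a' := a')) ` N" using in_upd b a' by blast
  qed
  have \<alpha>E: "\<alpha> e \<in> N" "\<alpha> e \<noteq> a" "\<alpha> e \<noteq> a'" "\<epsilon> (\<alpha> e) = e" "e \<noteq> a" "e \<noteq> a'" if "e \<in> ?E" for e
    using that a(2) a'(2) E idem_image[OF idem that] idem_image_in[OF idem that]
      idem_image_neq[OF that] by auto
  have g_a': "g a' = (if \<epsilon> a' = c then a else b)"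
    using N neq c b by (auto simp: g_def b_def transpose_def \<alpha>E)
  have g_E: "g (\<alpha> e) = (if e = c then a else e)" if "e \<in> ?E" for e
    using \<alpha>E[OF that] by (auto simp: g_def transpose_def)
  have h_a: "h a = a'" using N neq by (simp add: h_def b_def)
  have h_E: "h (\<alpha> e) = (if e = b then a' else e)" if "e \<in> ?E" for e
    using \<alpha>E[OF that] by (auto simp: h_def transpose_def)
  have g_im: "g u \<in> insert a ?E" if "u \<in> N" for u
    using that c by (auto simp: g_def transpose_def)
  define z where "z = g \<star> h"
  have z: "z \<in> T" unfolding z_def using T_star g h .
  \<comment> \<open>The map \<open>h\<close> takes the value \<open>b\<close> only at
    \<open>a'\<close>, and \<open>\<alpha>\<close> after \<open>g\<close> never reaches
    \<open>a'\<close>.\<close>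
  have z_im: "z u \<in> insert a' (?E - {b})" if "u \<in> N" for u
  proof (cases "g u = a")
    case True
    then show ?thesis using that h_a A_fix by (simp add: z_def star_apply)
  next
    case False
    then have "g u \<in> ?E" using g_im[OF that] by simp
    from h_E[OF this] this show ?thesis using that by (simp add: z_def star_apply)
  qed
  have z_a': "z a' = a'"
    using N g_a' h_a h_E b A_fix by (simp add: z_def star_apply)
  have z_E: "z (\<alpha> e) = (if e = c then a' else if e = b then a' else e)" if "e \<in> ?E" for e
    using \<alpha>E[OF that] g_E[OF that] h_a h_E[OF that] A_fix by (simp add: z_def star_apply)
  \<comment> \<open>In the second pass \<open>c\<close> is sent to \<open>a'\<close>, which stays
    there, while the image points other than \<open>b\<close> and \<open>c\<close> return to
    themselves; so nothing is mapped to \<open>c\<close> any more.\<close>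
  have zz: "(z \<star> z) ` N \<subseteq> insert a' (?E - {b, c})"
  proof (rule image_subsetI)
    fix u assume u: "u \<in> N"
    have zz_u: "(z \<star> z) u = z (\<alpha> (z u))" using u by (rule star_apply)
    show "(z \<star> z) u \<in> insert a' (?E - {b, c})"
    proof (cases "z u = a'")
      case True
      then show ?thesis using zz_u z_a' A_fix by simp
    next
      case False
      then have "z u \<in> ?E" using z_im[OF u] by simp
      from z_E[OF this] this show ?thesis using zz_u by simp
    qed
  qed
  have "z \<star> z \<in> T" using T_star z z .
  then obtain j where j: "j > 0" "idem (sg_pow (\<star>) (z \<star> z) j)"
    "sg_pow (\<star>) (z \<star> z) j ` N \<subseteq> (z \<star> z) ` N"
    using obtain_idem_power T_full by metis
  have "card (sg_pow (\<star>) (z \<star> z) j ` N) \<le> card (insert a' (?E - {b, c}))"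
    using j(3) zz by (intro card_mono) auto
  also have "\<dots> \<le> Suc (card ?E - 2)"
    using b c by (simp add: card_insert_if card_Diff_subset numeral_2_eq_2)
  also have "\<dots> < card ?E" using rank by simp
  finally show thesis using that j T_sg_pow \<open>z \<star> z \<in> T\<close> by blast
qed

text \<open>\<open>T_descend\<close> is iterated until the rank is 1. Since the rank only falls, the
  two free points it needs remain available.\<close>

lemma obtain_T_const:
  assumes "\<epsilon> \<in> T" "idem \<epsilon>" "card (\<epsilon> ` N) + 2 \<le> card (\<alpha> ` N)"
  obtains v where "v \<in> N" "(\<lambda>u\<in>N. v) \<in> T"
  using assms
proof (induction "card (\<epsilon> ` N)" arbitrary: \<epsilon> thesis rule: less_induct)
  case less
  show ?case
  proof (cases "card (\<epsilon> ` N) \<ge> 2")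
    case True
    then obtain \<delta> where \<delta>: "\<delta> \<in> T" "idem \<delta>" "card (\<delta> ` N) < card (\<epsilon> ` N)"
      using T_descend[OF less.prems(2,3) _ less.prems(4)] by blast
    show ?thesis
      by (rule less.hyps[OF \<delta>(3) less.prems(1) \<delta>(1,2)]) (use \<delta> less.prems(4) in simp_all)
  next
    case False
    then have "card (\<epsilon> ` N) = 1" using card_image_pos[of \<epsilon>] by linarith
    then obtain v where "v \<in> N" "\<epsilon> = (\<lambda>u\<in>N. v)" using idem_rank_1 less.prems(3) by blast
    then show ?thesis using less.prems(1,2) by simp
  qed
qed

section \<open>From one constant map to all constant maps\<close>

text \<open>A third point \<open>a\<close> of the image of \<open>\<alpha>\<close> makes both
  \<open>a\<close> and \<open>\<alpha> w\<close> free for the constant map with value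
  \<open>v\<close>, so each can be adjoined with the other as the auxiliary point. After the swaps,
  \<open>x\<close> takes only the values \<open>v\<close> and \<open>a\<close>, and \<open>y\<close>
  sends both \<open>\<alpha> v\<close> and \<open>a\<close> to \<open>w\<close>.\<close>

lemma T_const_step:
  assumes T: "(\<lambda>u\<in>N. v) \<in> T" and v: "v \<in> N" and w: "w \<in> N" and neq: "\<alpha> w \<noteq> \<alpha> v"
    and l: "card (\<alpha> ` N) > 2"
  shows "(\<lambda>u\<in>N. w) \<in> T"
proof -
  define \<epsilon> where "\<epsilon> = (\<lambda>u\<in>N. v)"
  have T: "\<epsilon> \<in> T" using T by (simp add: \<epsilon>_def)
  have idem: "idem \<epsilon>" unfolding \<epsilon>_def by (rule idemI) (use v alpha_in in \<open>auto intro: full_restrict\<close>)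
  have im: "\<alpha> ` \<epsilon> ` N = {\<alpha> v}" by (simp add: \<epsilon>_def image_constant_conv)
  have "\<not> \<alpha> ` N \<subseteq> {\<alpha> v, \<alpha> w}"
    using l card_mono[of "{\<alpha> v, \<alpha> w}" "\<alpha> ` N"] card_insert_le_m1[of 2 "{\<alpha> w}" "\<alpha> v"]
    by fastforce
  then obtain a where a: "a \<in> \<alpha> ` N" "a \<noteq> \<alpha> v" "a \<noteq> \<alpha> w" by blast
  have a_N: "a \<in> N" and A_fix: "\<alpha> a = a" using a alpha_in alpha_fix[OF a(1)] by auto
  define x where "x = (\<lambda>u\<in>N. transpose v a ((\<epsilon>(a := a)) u))"
  define y where "y = (\<lambda>u\<in>N. transpose v w ((\<epsilon>(\<alpha> w := w)) u))"
  have v_im: "v \<in> (\<epsilon>(p := q)) ` N" if "p \<noteq> \<alpha> v" for p q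
    using that v alpha_in[OF v] by (intro image_eqI[of _ _ "\<alpha> v"]) (auto simp: \<epsilon>_def)
  have x: "x \<in> T" unfolding x_def
  proof (rule T_transpose)
    show "\<epsilon>(a := a) \<in> T" by (rule T_adjoin[OF T idem, of _ "\<alpha> w"]) (use a a_N A_fix im w neq in auto)
    show "idem (\<epsilon>(a := a))" by (rule idem_upd[OF idem]) (use a a_N A_fix im in auto)
    show "v \<in> (\<epsilon>(a := a)) ` N" by (rule v_im[OF a(2)])
    show "a \<in> (\<epsilon>(a := a)) ` N" using a_N by (metis fun_upd_same imageI)
  qed
  have y: "y \<in> T" unfolding y_def
  proof (rule T_transpose)
    show "\<epsilon>(\<alpha> w := w) \<in> T" by (rule T_adjoin[OF T idem, of _ a]) (use a im w neq in auto)
    show "idem (\<epsilon>(\<alpha> w := w))" by (rule idem_upd[OF idem]) (use w alpha_in im neq in auto)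
    show "v \<in> (\<epsilon>(\<alpha> w := w)) ` N" by (rule v_im[OF neq])
    show "w \<in> (\<epsilon>(\<alpha> w := w)) ` N" using alpha_in[OF w] by (metis fun_upd_same imageI)
  qed
  have x_im: "x u \<in> {v, a}" if "u \<in> N" for u
    using that by (auto simp: x_def \<epsilon>_def)
  have y_im: "y (\<alpha> v) = w" "y a = w"
    using neq a a_N alpha_in[OF v] by (auto simp: y_def \<epsilon>_def)
  show ?thesis
  proof (rule T_starI[OF x y])
    show "(\<lambda>u\<in>N. w) \<in> full_transf n" using w by (intro full_restrict)
    show "y (\<alpha> (x u)) = (\<lambda>u\<in>N. w) u" if "u \<in> N" for u
      using x_im[OF that] that y_im A_fix by auto
  qed
qed

text \<open>When \<open>v\<close> and \<open>w\<close> have the same image under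
  \<open>\<alpha>\<close>, a detour through some \<open>t\<close> with a different image gives two
  applications of \<open>T_const_step\<close>.\<close>

lemma T_all_const:
  assumes T: "(\<lambda>u\<in>N. v) \<in> T" and v: "v \<in> N" and w: "w \<in> N" and l: "card (\<alpha> ` N) > 2"
  shows "(\<lambda>u\<in>N. w) \<in> T"
proof (cases "\<alpha> w = \<alpha> v")
  case True
  have "\<not> \<alpha> ` N \<subseteq> {\<alpha> v}" using l card_mono[of "{\<alpha> v}" "\<alpha> ` N"] by fastforce
  then obtain t where t: "t \<in> N" "\<alpha> t \<noteq> \<alpha> v" by blast
  then have "(\<lambda>u\<in>N. t) \<in> T" using T_const_step[OF T v] l by blast
  then show ?thesis using T_const_step t w l True by metis
next
  case False
  then show ?thesis using T_const_step[OF T v w _ l] by blast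
qed

section \<open>Ascent from the constant maps\<close>

text \<open>The idempotent power of the square has its image inside that of the square, so the
  induction hypothesis puts it into \<open>T\<close>. Isolation then leads back to the square and
  from there to \<open>x\<close>. Bounding the rank of a square thus replaces computing a stable
  rank.\<close>

lemma T_of_square_rank:
  assumes IH: "\<And>\<epsilon>. idem \<epsilon> \<Longrightarrow> card (\<epsilon> ` N) < k \<Longrightarrow> \<epsilon> \<in> T"
    and x: "x \<in> full_transf n" and k: "card ((x \<star> x) ` N) < k"
  shows "x \<in> T"
proof -
  have xx: "x \<star> x \<in> full_transf n" using x star_full by blast
  then obtain j where j: "j > 0" "idem (sg_pow (\<star>) (x \<star> x) j)"
    "sg_pow (\<star>) (x \<star> x) j ` N \<subseteq> (x \<star> x) ` N"
    using obtain_idem_power by metis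
  have "card (sg_pow (\<star>) (x \<star> x) j ` N) < k"
    using card_mono[OF _ j(3)] k by simp
  then have "x \<star> x \<in> T" using IH j T_root[OF xx] by blast
  then show ?thesis using T_square_root x by blast
qed

text \<open>The factors arise by moving the image point \<open>\<alpha> c\<close> of \<open>\<epsilon>\<close> to the free point \<open>a\<close> and back:
  \<open>a\<close> and \<open>\<alpha> c\<close> become transient for \<open>x\<close> and \<open>y\<close>, respectively, which lowers the stable rank.\<close>

lemma T_ascend:
  assumes idem: "idem \<epsilon>"
    and rank: "card (\<epsilon> ` N) \<ge> 2" "card (\<epsilon> ` N) < card (\<alpha> ` N)"
    and IH: "\<And>\<delta>. idem \<delta> \<Longrightarrow> card (\<delta> ` N) < card (\<epsilon> ` N) \<Longrightarrow> \<delta> \<in> T"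
  shows "\<epsilon> \<in> T"
proof -
  let ?E = "\<epsilon> ` N"
  have "\<not> \<alpha> ` N \<subseteq> \<alpha> ` ?E"
    using rank card_alpha_image[OF idem] card_mono[of "\<alpha> ` ?E" "\<alpha> ` N"] by fastforce
  then obtain a where a: "a \<in> \<alpha> ` N" "a \<notin> \<alpha> ` ?E" by blast
  have a_N: "a \<in> N" and A_fix: "\<alpha> a = a" using a alpha_in alpha_fix[OF a(1)] by auto
  have "\<not> card ?E \<le> Suc 0" using rank by simp
  \<comment> \<open>The condition \<open>c \<noteq> \<epsilon> a\<close> keeps \<open>c\<close> out
    of both squares: \<open>x\<close> sends \<open>a\<close> to
    \<open>\<alpha> (\<epsilon> a)\<close>, and \<open>y\<close> sends \<open>\<alpha> c\<close> to
    \<open>\<epsilon> a\<close>.\<close>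
  then obtain c where c: "c \<in> ?E" "c \<noteq> \<epsilon> a"
    using a_N by (auto simp: card_le_Suc0_iff_eq) (metis image_eqI)
  have \<alpha>E: "e \<in> N" "\<alpha> e \<in> N" "\<alpha> e \<noteq> a" "\<epsilon> (\<alpha> e) = e" "\<alpha> (\<alpha> e) = \<alpha> e" if "e \<in> ?E" for e
    using a(2) idem_image[OF idem that] idem_image_in[OF idem that] idem_image_neq[OF that]
      alpha_alpha by simp_all
  have \<epsilon>E: "\<epsilon> u \<in> ?E" if "u \<in> N" for u using that by blast
  have inj: "\<alpha> e = \<alpha> c \<longleftrightarrow> e = c" if "e \<in> ?E" for e
    using \<alpha>E(4)[OF that] \<alpha>E(4)[OF c(1)] by metis
  have card_less: "card (?E - {c}) < card ?E" using c by (intro card_Diff1_less) auto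
  define x where "x = (\<lambda>u\<in>N. if \<epsilon> u = c then a else \<alpha> (\<epsilon> u))"
  define y where "y = \<epsilon>(a := c, \<alpha> c := \<epsilon> a)"
  have x_full: "x \<in> full_transf n"
    unfolding x_def by (rule full_restrict) (use a_N \<alpha>E \<epsilon>E in auto)
  have y_full: "y \<in> full_transf n"
    unfolding y_def using a_N c \<alpha>E \<epsilon>E idem_full[OF idem] by (intro full_upd) auto
  have "(x \<star> x) ` N \<subseteq> \<alpha> ` (?E - {c})"
  proof (clarify)
    fix u assume u: "u \<in> N"
    show "(x \<star> x) u \<in> \<alpha> ` (?E - {c})"
      using u a_N c A_fix \<epsilon>E[OF u] \<epsilon>E[OF a_N] \<alpha>E[OF \<epsilon>E[OF u]] by (auto simp: star_apply x_def)
  qed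
  then have "card ((x \<star> x) ` N) \<le> card (?E - {c})"
    by (metis card_image_le card_mono finite_Diff finite_imageI finite_N order_trans)
  then have x: "x \<in> T" using T_of_square_rank[OF IH x_full] card_less by simp
  have "(y \<star> y) ` N \<subseteq> ?E - {c}"
  proof (clarify)
    fix u assume u: "u \<in> N"
    have "y u \<in> ?E" using u a_N c by (auto simp: y_def)
    then show "(y \<star> y) u \<in> ?E - {c}"
      using u a_N c \<alpha>E[of "y u"] inj[of "y u"] \<epsilon>E[OF a_N] by (auto simp: star_apply y_def)
  qed
  then have "card ((y \<star> y) ` N) \<le> card (?E - {c})" by (intro card_mono) auto
  then have y: "y \<in> T" using T_of_square_rank[OF IH y_full] card_less by simp
  show ?thesis
  proof (rule T_starI[OF x y idem_full[OF idem]])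
    show "y (\<alpha> (x u)) = \<epsilon> u" if u: "u \<in> N" for u
      using u A_fix \<alpha>E[OF \<epsilon>E[OF u]] \<alpha>E[OF c(1)] inj[OF \<epsilon>E[OF u]] by (auto simp: x_def y_def)
  qed
qed

lemma T_all_idem:
  assumes "(\<lambda>u\<in>N. v) \<in> T" "v \<in> N" "card (\<alpha> ` N) > 2" "idem \<epsilon>" "card (\<epsilon> ` N) < card (\<alpha> ` N)"
  shows "\<epsilon> \<in> T"
  using assms(4,5)
proof (induction "card (\<epsilon> ` N)" arbitrary: \<epsilon> rule: less_induct)
  case less
  show ?case
  proof (cases "card (\<epsilon> ` N) \<ge> 2")
    case True
    then show ?thesis using T_ascend less by (meson order_less_trans)
  next
    case False
    then have "card (\<epsilon> ` N) = 1" using card_image_pos[of \<epsilon>] by linarith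
    then obtain w where "w \<in> N" "\<epsilon> = (\<lambda>u\<in>N. w)" using idem_rank_1 less.prems(1) by blast
    then show ?thesis using T_all_const assms(1-3) by simp
  qed
qed

end

theorem proposition24:
  fixes n l :: nat and \<alpha> :: "nat \<Rightarrow> nat" and T :: "(nat \<Rightarrow> nat) set"
  assumes "n \<ge> 1"
    and "\<alpha> \<in> full_transf n"
    and "tmult n \<alpha> \<alpha> = \<alpha>"
    and "trank n \<alpha> = l"
    and "l > 2"
    and "isolated_subsemigroup (full_transf n) (variant_mult n \<alpha>) T"
    and "\<not> T \<subseteq> stable_rank_class n \<alpha> l \<union> stable_rank_class n \<alpha> (l - 1)"
  shows "full_transf n - stable_rank_class n \<alpha> l \<subseteq> T"
proof -
  interpret isolated_variant n \<alpha> T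
    using assms by unfold_locales
  have l: "card (\<alpha> ` N) = l" using assms by (simp add: trank_N)
  obtain \<beta> where \<beta>: "\<beta> \<in> T" "stable_rank n \<alpha> \<beta> \<noteq> l" "stable_rank n \<alpha> \<beta> \<noteq> l - 1"
    using assms(7) T_full by (auto simp: stable_rank_class_def)
  obtain j where j: "j > 0" "idem (sg_pow (\<star>) \<beta> j)"
    "stable_rank n \<alpha> \<beta> = card (sg_pow (\<star>) \<beta> j ` N)"
    using obtain_idem_power T_full \<beta>(1) by metis
  \<comment> \<open>The stable rank is at most \<open>l\<close>, and the values \<open>l\<close> and
    \<open>l - 1\<close> are excluded; this leaves exactly the gap of two that the descent
    requires.\<close>
  have "card (sg_pow (\<star>) \<beta> j ` N) + 2 \<le> card (\<alpha> ` N)"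
    using \<beta> j l card_idem_le[OF j(2)] by linarith
  then obtain v where v: "v \<in> N" "(\<lambda>u\<in>N. v) \<in> T"
    using obtain_T_const T_sg_pow \<beta>(1) j by blast
  show ?thesis
  proof
    fix \<gamma> assume "\<gamma> \<in> full_transf n - stable_rank_class n \<alpha> l"
    then have \<gamma>: "\<gamma> \<in> full_transf n" "stable_rank n \<alpha> \<gamma> \<noteq> l"
      by (auto simp: stable_rank_class_def)
    then obtain i where i: "i > 0" "idem (sg_pow (\<star>) \<gamma> i)"
      "stable_rank n \<alpha> \<gamma> = card (sg_pow (\<star>) \<gamma> i ` N)"
      using obtain_idem_power by metis
    then have "card (sg_pow (\<star>) \<gamma> i ` N) < card (\<alpha> ` N)"
      using card_idem_le[OF i(2)] l \<gamma> by linarith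
    then have "sg_pow (\<star>) \<gamma> i \<in> T"
      using T_all_idem v i l \<open>l > 2\<close> by blast
    then show "\<gamma> \<in> T" using T_root \<gamma> i by blast
  qed
qed

end
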